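(* Let $(A,R)$ be a modified Rota-Baxter algebra of weight $\kappa\in\mathbf{k}$. Then: (i) The underlying vector space $A$ carries an associative algebra structure with the product $a*_Rb=R(a)\cdot b+a\cdot R(b)$, for $a,b\in A$. Denote this associative algebra by $A_R$. (ii) The pair $(A_R,R)$ is a modified Rota-Baxter algebra of weight $\kappa$.
   Context: Everything is over a field $\mathbf{k}$ of characteristic $0$; algebras are associative (not necessarily unital). A modified Rota-Baxter algebra of weight $\kappa$ is a pair $(A,R)$ of an algebra $A$ and a linear map $R:A\to A$ with $R(a)\cdot R(b)=R(R(a)\cdot b+a\cdot R(b))+\kappa\,a\cdot b$ for all $a,b\in A$. *)

theory Defs
  imports Complex_Main
begin

text \<open>
  The ground field is a type of class \<open>field_char_0\<close>, and the underlying vector space of an algebra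
  is a whole type with an explicit scalar multiplication \<open>scale\<close>. The product is an explicit
  parameter, so that one vector space can carry several algebra structures; no unit is required.
\<close>

locale associative_algebra = vector_space scale
  for scale :: "'k::field_char_0 \<Rightarrow> 'a::ab_group_add \<Rightarrow> 'a" +
  fixes mult :: "'a \<Rightarrow> 'a \<Rightarrow> 'a"
  assumes mult_linear_left: "Vector_Spaces.linear scale scale (\<lambda>a. mult a b)"
    and mult_linear_right: "Vector_Spaces.linear scale scale (\<lambda>b. mult a b)"
    and mult_assoc: "mult (mult a b) c = mult a (mult b c)"

locale modified_rota_baxter_algebra = associative_algebra scale mult
  for scale :: "'k::field_char_0 \<Rightarrow> 'a::ab_group_add \<Rightarrow> 'a"
    and mult :: "'a \<Rightarrow> 'a \<Rightarrow> 'a" +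
  fixes R :: "'a \<Rightarrow> 'a" and \<kappa> :: 'k
  assumes R_linear: "Vector_Spaces.linear scale scale R"
    and modified_rota_baxter:
      "mult (R a) (R b) = R (mult (R a) b + mult a (R b)) + scale \<kappa> (mult a b)"

definition induced_mult :: "('a::ab_group_add \<Rightarrow> 'a \<Rightarrow> 'a) \<Rightarrow> ('a \<Rightarrow> 'a) \<Rightarrow> 'a \<Rightarrow> 'a \<Rightarrow> 'a"
  where "induced_mult mult R a b = mult (R a) b + mult a (R b)"

end

theory Submission
  imports Defs
begin

text \<open>Write \<open>a * b\<close> for the induced product and \<open>ab\<close> for the
  original one. The modified Rota-Baxter identity says exactly that
  \<open>R (a * b) = R(a)R(b) - \<kappa> ab\<close> (\<open>R_induced_mult\<close>), so every
  \<open>R\<close> of an induced product can be eliminated. Both bracketings of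
  \<open>a * b * c\<close> then expand to
  \<open>R(a)R(b)c + R(a)bR(c) + aR(b)R(c) - \<kappa> abc\<close>, which gives associativity. For
  the identity on the new algebra, the same elimination applied to \<open>R (R(a) * b)\<close> and
  \<open>R (a * R(b))\<close> leaves error terms that add up to
  \<open>- \<kappa> (a * b)\<close>.\<close>

context associative_algebra
begin

lemma mult_add_left: "mult (a + b) c = mult a c + mult b c"
  using mult_linear_left[of c] unfolding linear_iff_module_hom by (rule module_hom.add)

lemma mult_add_right: "mult a (b + c) = mult a b + mult a c"
  using mult_linear_right[of a] unfolding linear_iff_module_hom by (rule module_hom.add)

lemma mult_diff_left: "mult (a - b) c = mult a c - mult b c"
  using mult_linear_left[of c] unfolding linear_iff_module_hom by (rule module_hom.diff)

lemma mult_diff_right: "mult a (b - c) = mult a b - mult a c"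
  using mult_linear_right[of a] unfolding linear_iff_module_hom by (rule module_hom.diff)

lemma mult_scale_left: "mult (scale r a) b = scale r (mult a b)"
  using mult_linear_left[of b] unfolding linear_iff_module_hom by (rule module_hom.scale)

lemma mult_scale_right: "mult a (scale r b) = scale r (mult a b)"
  using mult_linear_right[of a] unfolding linear_iff_module_hom by (rule module_hom.scale)

end

context modified_rota_baxter_algebra
begin

lemma R_add: "R (a + b) = R a + R b"
  using R_linear unfolding linear_iff_module_hom by (rule module_hom.add)

lemma R_scale: "R (scale r a) = scale r (R a)"
  using R_linear unfolding linear_iff_module_hom by (rule module_hom.scale)

text \<open>The defining identity solved for its \<open>R\<close> term: \<open>R\<close> maps the
  induced product to the original one multiplicatively, up to a defect governed by \<kappa>. Both
  halves of the theorem rest on it.\<close>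

lemma R_induced_mult:
  "R (induced_mult mult R a b) = mult (R a) (R b) - scale \<kappa> (mult a b)"
  unfolding induced_mult_def modified_rota_baxter by simp

lemma induced_mult_assoc:
  "induced_mult mult R (induced_mult mult R a b) c =
   induced_mult mult R a (induced_mult mult R b c)"
proof -
  have "induced_mult mult R (induced_mult mult R a b) c =
      mult (mult (R a) (R b) - scale \<kappa> (mult a b)) c + mult (mult (R a) b + mult a (R b)) (R c)"
    \<comment> \<open>Fixing the right factor \<open>c\<close> unfolds only the outer product; the
      inner one must stay folded under \<open>R\<close> for \<open>R_induced_mult\<close> to
      apply.\<close>
    unfolding induced_mult_def[of mult R _ c] R_induced_mult by (simp add: induced_mult_def)
  also have "\<dots> = mult (R a) (mult (R b) c + mult b (R c))
      + mult a (mult (R b) (R c) - scale \<kappa> (mult b c))"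
    \<comment> \<open>Bilinearity and associativity of \<open>mult\<close> bring both sides to the
      same four terms; the scalar \<kappa> moves freely through products, so the two defects
      coincide.\<close>
    by (simp add: mult_add_left mult_add_right mult_diff_left mult_diff_right
        mult_scale_left mult_scale_right mult_assoc)
  also have "\<dots> = induced_mult mult R a (induced_mult mult R b c)"
    unfolding induced_mult_def[of mult R a] R_induced_mult by (simp add: induced_mult_def)
  finally show ?thesis .
qed

lemma induced_associative_algebra: "associative_algebra scale (induced_mult mult R)"
proof unfold_locales
  show "induced_mult mult R (a + b) c = induced_mult mult R a c + induced_mult mult R b c" for a b c
    by (simp add: induced_mult_def R_add mult_add_left)
  show "induced_mult mult R (scale r a) b = scale r (induced_mult mult R a b)" for r a b
    by (simp add: induced_mult_def R_scale mult_scale_left scale_right_distrib)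
  show "induced_mult mult R a (b + c) = induced_mult mult R a b + induced_mult mult R a c" for a b c
    by (simp add: induced_mult_def R_add mult_add_right)
  show "induced_mult mult R a (scale r b) = scale r (induced_mult mult R a b)" for r a b
    by (simp add: induced_mult_def R_scale mult_scale_right scale_right_distrib)
qed (rule induced_mult_assoc)

text \<open>On the right, \<open>R_induced_mult\<close> produces
  \<open>R(R(a))R(b) + R(a)R(R(b))\<close>, which is the left side, together with
  \<open>- \<kappa> R(a)b - \<kappa> aR(b)\<close>, which the weight term cancels.\<close>

lemma induced_modified_rota_baxter:
  "induced_mult mult R (R a) (R b) =
   R (induced_mult mult R (R a) b + induced_mult mult R a (R b))
     + scale \<kappa> (induced_mult mult R a b)"
  unfolding R_add R_induced_mult
  by (simp add: induced_mult_def scale_right_distrib)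

end

theorem proposition2p9:
  fixes scale :: "'k::field_char_0 \<Rightarrow> 'a::ab_group_add \<Rightarrow> 'a"
    and mult :: "'a \<Rightarrow> 'a \<Rightarrow> 'a"
    and R :: "'a \<Rightarrow> 'a"
    and \<kappa> :: 'k
  assumes "modified_rota_baxter_algebra scale mult R \<kappa>"
  shows "associative_algebra scale (induced_mult mult R) \<and>
    modified_rota_baxter_algebra scale (induced_mult mult R) R \<kappa>"
proof -
  interpret modified_rota_baxter_algebra scale mult R \<kappa>
    by (rule assms)
  \<comment> \<open>With the algebra axioms for the induced product available, only the conditions
    on \<open>R\<close> remain to be checked for the second claim.\<close>
  interpret induced: associative_algebra scale "induced_mult mult R"
    by (rule induced_associative_algebra)
  have "modified_rota_baxter_algebra scale (induced_mult mult R) R \<kappa>"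
    by unfold_locales (rule R_add R_scale induced_modified_rota_baxter)+
  with induced_associative_algebra show ?thesis
    by blast
qed

end
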